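(* Let $n$ be an odd positive integer and let $G=G_1+G_2+\cdots+G_l$, where each $G_i$ is a unicyclic graph of the form $G_i=(T_1^i(w_1^i),T_2^i(w_2^i),\dots,T_{m_i}^i(w_{m_i}^i))$ with cycle of length $m_i$. Let $I=\{1,\dots,l\}$ and let $J\subseteq I$ be such that for every $i\in J$ with $m_i$ odd we have $m_i\ge n$. If $G$ has an edge-magic labeling (respectively, a super edge-magic labeling), then $$\Big(\sum_{j\in J}nG_j\Big)+\Big(\sum_{i\in I\setminus J}G_i^{n}\Big)$$ has an edge-magic labeling (respectively, a super edge-magic labeling).
   Context: All graphs are simple. Notation: for trees $T_1,\dots,T_m$ and $w_j\in V(T_j)$, $(T_1(w_1),\dots,T_m(w_m))$ is the unicyclic graph obtained from a cycle $a_1\cdots a_m$ and disjoint copies of the $T_j$ by identifying $w_j$ with $a_j$. For such a graph $H$ and $k\ge1$, $H^k$ denotes $(T_1(w_1),\dots,T_m(w_m),\dots,T_1(w_1),\dots,T_m(w_m))$ with the block of $m$ entries repeated $k$ times (cycle length $mk$). Sums are disjoint unions and $nH$ is $n$ disjoint copies of $H$. An edge-magic labeling of a graph with $p$ vertices and $q$ edges is a bijection $f:V\cup E\to\{1,\dots,p+q\}$ with $f(x)+f(xy)+f(y)$ constant over all edges; it is super edge-magic if also $f(V)=\{1,\dots,p\}$. *)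

theory Defs
  imports Main
begin

datatype 'a sgraph = SGraph (verts: "'a set") (edges: "'a set set")

definition simple_graph :: "'a sgraph \<Rightarrow> bool" where
  "simple_graph G \<longleftrightarrow> finite (verts G) \<and> (\<forall>e\<in>edges G. e \<subseteq> verts G \<and> card e = 2)"

definition connected_graph :: "'a sgraph \<Rightarrow> bool" where
  "connected_graph G \<longleftrightarrow> verts G \<noteq> {} \<and>
     (\<forall>u\<in>verts G. \<forall>v\<in>verts G. (u, v) \<in> {(x, y). {x, y} \<in> edges G}\<^sup>*)"

definition is_cycle :: "'a sgraph \<Rightarrow> 'a list \<Rightarrow> bool" where
  "is_cycle G c \<longleftrightarrow> 3 \<le> length c \<and> distinct c \<and>
     (\<forall>i<length c. {c ! i, c ! (Suc i mod length c)} \<in> edges G)"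

definition tree :: "'a sgraph \<Rightarrow> bool" where
  "tree G \<longleftrightarrow> simple_graph G \<and> connected_graph G \<and> (\<nexists>c. is_cycle G c)"

definition disjoint_sum :: "'i set \<Rightarrow> ('i \<Rightarrow> 'a sgraph) \<Rightarrow> ('i \<times> 'a) sgraph" where
  "disjoint_sum I G =
     SGraph (SIGMA i:I. verts (G i)) (\<Union>i\<in>I. (\<lambda>e. Pair i ` e) ` edges (G i))"

definition disjoint_plus :: "'a sgraph \<Rightarrow> 'b sgraph \<Rightarrow> ('a + 'b) sgraph" where
  "disjoint_plus G H =
     SGraph (verts G <+> verts H) ((\<lambda>e. Inl ` e) ` edges G \<union> (\<lambda>e. Inr ` e) ` edges H)"

definition copies :: "nat \<Rightarrow> 'a sgraph \<Rightarrow> (nat \<times> 'a) sgraph" where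
  "copies n G = disjoint_sum {1..n} (\<lambda>_. G)"

text \<open>The list of pairs \<open>(T, w)\<close> stands for the tuple $(T_1(w_1),\dots,T_m(w_m))$. It is
  admissible if every \<open>T\<close> is a tree containing \<open>w\<close> and the cycle has length at least three,
  as it must in a simple graph.\<close>

type_synonym 'a unicyclic = "('a sgraph \<times> 'a) list"

definition unicyclic :: "'a unicyclic \<Rightarrow> bool" where
  "unicyclic ts \<longleftrightarrow> 3 \<le> length ts \<and> (\<forall>(T, w)\<in>set ts. tree T \<and> w \<in> verts T)"

text \<open>The identification of the cycle vertex \<open>a\<^sub>j\<close> with the root \<open>w\<^sub>j\<close> of the \<open>j\<close>-th copy is
  realised without a quotient: the vertex \<open>(j, w\<^sub>j)\<close> of the disjoint union of the trees plays
  the role of \<open>a\<^sub>j\<close>, and the edges of the cycle are added between these. Positions count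
  from 0.\<close>

definition cycle_edges :: "'a unicyclic \<Rightarrow> (nat \<times> 'a) set set" where
  "cycle_edges ts =
     (let a = (\<lambda>j. (j, snd (ts ! j))) in
        {{a j, a (Suc j mod length ts)} | j. j < length ts})"

definition unicyclic_graph :: "'a unicyclic \<Rightarrow> (nat \<times> 'a) sgraph" where
  "unicyclic_graph ts =
     (let D = disjoint_sum {..<length ts} (\<lambda>j. fst (ts ! j)) in
        SGraph (verts D) (edges D \<union> cycle_edges ts))"

definition unicyclic_power :: "'a unicyclic \<Rightarrow> nat \<Rightarrow> 'a unicyclic" where
  "unicyclic_power ts k = concat (replicate k ts)"

definition edge_magic_labeling :: "'a sgraph \<Rightarrow> ('a + 'a set \<Rightarrow> nat) \<Rightarrow> bool" where
  "edge_magic_labeling G f \<longleftrightarrow>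
     bij_betw f (verts G <+> edges G) {1..card (verts G) + card (edges G)} \<and>
     (\<exists>k. \<forall>x y. {x, y} \<in> edges G \<longrightarrow> f (Inl x) + f (Inr {x, y}) + f (Inl y) = k)"

definition super_edge_magic_labeling :: "'a sgraph \<Rightarrow> ('a + 'a set \<Rightarrow> nat) \<Rightarrow> bool" where
  "super_edge_magic_labeling G f \<longleftrightarrow>
     edge_magic_labeling G f \<and> f ` Inl ` verts G = {1..card (verts G)}"

end

theory Submission
  imports Defs "HOL-Number_Theory.Cong"
begin

text \<open>Write \<open>n = 2 k + 1\<close>. The graph \<open>H\<close> is an \<open>n\<close>-fold cyclic cover of \<open>G\<close>: its vertices are pairs of a
  vertex of \<open>G\<close> and a level in \<open>\<int>/n\<close>, and over every edge of \<open>G\<close> the level changes by a fixed voltage.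
  If all voltages are halves of \<open>\<plusminus>1\<close> modulo \<open>n\<close>, the level sums of the \<open>n\<close> edges over a given edge of
  \<open>G\<close> are exactly \<open>k, \<dots>, 3 k\<close>. So one may blow up every label of \<open>G\<close> to a block of \<open>n\<close> labels, and
  number the vertices inside a block by their level and the edges by decreasing level sum.

  Trees impose no condition on voltages, being bipartite. Around a cycle of length \<open>m\<close> the signs of the
  voltages can be chosen to sum to any number of the parity of \<open>m\<close> between \<open>-m\<close> and \<open>m\<close>. A multiple
  of \<open>n\<close> yields \<open>n\<close> copies, which for odd \<open>m\<close> requires \<open>n \<le> m\<close>; the sums 1 and 2 are coprime to \<open>n\<close>
  and yield the \<open>n\<close>-th power.\<close>

section \<open>Trees are bipartite\<close>

text \<open>This is \<open>is_cycle\<close> freed from distinctness and the length bound, so that a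
  walk can be cut at a repeated vertex.\<close>

definition closed_walk :: "'a sgraph \<Rightarrow> 'a list \<Rightarrow> bool" where
  "closed_walk G c \<longleftrightarrow> c \<noteq> [] \<and> (\<forall>i<length c. {c ! i, c ! (Suc i mod length c)} \<in> edges G)"

text \<open>Appending the first vertex turns the cyclic condition into a linear one, to which the
  append rules of \<open>successively\<close> apply.\<close>

lemma closed_walk_iff_successively:
  "closed_walk G (a # c) \<longleftrightarrow> successively (\<lambda>x y. {x, y} \<in> edges G) (a # c @ [a])"
proof -
  have "(a # c @ [a]) ! i = (a # c) ! i" if "i < Suc (length c)" for i
    using that by (cases i) (auto simp: nth_append)
  moreover have "(a # c @ [a]) ! Suc i = (a # c) ! (Suc i mod Suc (length c))"
    if "i < Suc (length c)" for i
    using that by (cases "i = length c") (auto simp: nth_append)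
  ultimately show ?thesis
    by (auto simp: closed_walk_def successively_conv_nth)
qed

lemma closed_walk_split:
  assumes "closed_walk G (xs @ a # ys @ a # zs)"
  shows "closed_walk G (a # ys)" and "closed_walk G (xs @ a # zs)"
proof -
  \<comment> \<open>The first vertex \<open>b\<close> is the head of \<open>xs\<close> or, for empty
    \<open>xs\<close>, \<open>a\<close> itself; naming it treats both cases at once.\<close>
  obtain b bs where b: "xs @ [a] = b # bs"
    by (cases "xs @ [a]") auto
  have 1: "xs @ a # ys @ a # zs = b # (bs @ ys @ a # zs)" and 2: "xs @ a # zs = b # (bs @ zs)"
    using b by (metis append.assoc append_Cons append_Nil)+
  have 3: "b # (bs @ ys @ a # zs) @ [b] = xs @ a # ys @ a # zs @ [b]"
    and 4: "b # (bs @ zs) @ [b] = xs @ a # zs @ [b]"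
    using 1 2 by (metis append.assoc append_Cons)+
  have *: "successively (\<lambda>x y. {x, y} \<in> edges G) (xs @ a # ys @ a # zs @ [b])"
    using assms unfolding 1 closed_walk_iff_successively 3 .
  have "xs @ a # ys @ a # zs @ [b] = xs @ (a # ys @ [a]) @ zs @ [b]"
    by simp
  then show "closed_walk G (a # ys)"
    using * unfolding closed_walk_iff_successively by (simp only: successively_append_iff)
  show "closed_walk G (xs @ a # zs)"
    unfolding 2 closed_walk_iff_successively 4
    using * by (auto simp: successively_append_iff successively_Cons)
qed

text \<open>Induction on the length: cutting at a repeated vertex gives two shorter closed walks
  whose lengths add up to an odd number, so one of them is odd. Without a repetition, length 1 would
  be a loop, and parity excludes 0 and 2.\<close>

lemma odd_closed_walk_imp_cycle:
  assumes "simple_graph G" "closed_walk G c" "odd (length c)"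
  shows "\<exists>c. is_cycle G c"
  using assms(2,3)
proof (induction c rule: length_induct)
  case (1 c)
  show ?case
  proof (cases "distinct c")
    case True
    have "length c \<noteq> 1"
    proof
      assume "length c = 1"
      then have "{c ! 0} \<in> edges G"
        using 1(2) by (auto simp: closed_walk_def)
      then show False
        using assms(1) by (force simp: simple_graph_def)
    qed
    moreover have "length c \<noteq> 0" "length c \<noteq> 2"
      using 1(3) by (auto elim: oddE)
    ultimately have "3 \<le> length c" by linarith
    then show ?thesis
      using True 1(2) by (auto simp: is_cycle_def closed_walk_def)
  next
    case False
    then obtain xs ys zs a where c: "c = xs @ [a] @ ys @ [a] @ zs"
      using not_distinct_decomp by blast
    then have "closed_walk G (a # ys)" "closed_walk G (xs @ a # zs)"
      using 1(2) closed_walk_split[of G xs a ys zs] by auto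
    moreover have "odd (length (a # ys)) \<or> odd (length (xs @ a # zs))"
      using 1(3) c by auto
    moreover have "length (a # ys) < length c" "length (xs @ a # zs) < length c"
      using c by auto
    ultimately show ?thesis
      using 1(1) by blast
  qed
qed

text \<open>The colour is the parity of the length of a walk from \<open>w\<close>. Two walks of
  different parity to the same vertex would combine to an odd closed walk, hence yield a cycle.
  Colours are integers because their differences become the signs of voltages.\<close>

lemma tree_bipartite:
  assumes "tree T" "w \<in> verts T"
  obtains c :: "'a \<Rightarrow> int"
  where "c w = 0" "\<And>u v. {u, v} \<in> edges T \<Longrightarrow> \<bar>c v - c u\<bar> = 1"
proof -
  define E where "E = {(x, y). {x, y} \<in> edges T}"
  have sym: "sym E"
    by (auto simp: E_def sym_def insert_commute)
  have flip: "(y, x) \<in> E ^^ k" if "(x, y) \<in> E ^^ k" for x y k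
    using that
    by (induction k arbitrary: y)
      (auto dest: symD[OF sym] intro: relpow_Suc_I2 simp del: relpow.simps(2) elim!: relpow_Suc_E)
  \<comment> \<open>The list omits the last vertex \<open>y\<close>, so that for
    \<open>x = y\<close> it is a closed walk.\<close>
  have walk: "\<exists>xs. length xs = k \<and> successively (\<lambda>x y. {x, y} \<in> edges T) (xs @ [y]) \<and> hd (xs @ [y]) = x"
    if "(x, y) \<in> E ^^ k" for x y k
    using that
  proof (induction k arbitrary: x)
    case 0
    then show ?case by simp
  next
    case (Suc k)
    then obtain z where z: "(x, z) \<in> E" "(z, y) \<in> E ^^ k"
      by (meson relpow_Suc_D2)
    with Suc.IH obtain xs where
      "length xs = k" "successively (\<lambda>x y. {x, y} \<in> edges T) (xs @ [y])" "hd (xs @ [y]) = z"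
      by blast
    then show ?case
      using z by (intro exI[of _ "x # xs"]) (auto simp: successively_Cons E_def)
  qed
  have even_closed: "even k" if "(x, x) \<in> E ^^ k" for x k
  proof (rule ccontr)
    assume "odd k"
    obtain xs where xs: "length xs = k" "successively (\<lambda>x y. {x, y} \<in> edges T) (xs @ [x])"
      "hd (xs @ [x]) = x"
      using walk \<open>(x, x) \<in> E ^^ k\<close> by blast
    moreover obtain ys where "xs = x # ys"
      using xs \<open>odd k\<close> by (cases xs) auto
    ultimately have "closed_walk T xs"
      by (simp add: closed_walk_iff_successively)
    then have "\<exists>c. is_cycle T c"
      using odd_closed_walk_imp_cycle assms(1) \<open>odd k\<close> xs(1) by (auto simp: tree_def)
    then show False
      using assms(1) by (auto simp: tree_def)
  qed
  define c :: "'a \<Rightarrow> int" where "c v = (if \<exists>k. even k \<and> (w, v) \<in> E ^^ k then 0 else 1)" for v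
  have "c w = 0"
    unfolding c_def by (auto intro!: exI[of _ 0])
  moreover have "\<bar>c v - c u\<bar> = 1" if "{u, v} \<in> edges T" for u v
  proof -
    have uv: "(u, v) \<in> E"
      using that by (simp add: E_def)
    have "u \<in> verts T"
      using that assms(1) by (auto simp: tree_def simple_graph_def)
    then have "(w, u) \<in> E\<^sup>*"
      using assms by (auto simp: tree_def connected_graph_def E_def)
    then obtain k where k: "(w, u) \<in> E ^^ k"
      using rtrancl_imp_relpow by blast
    then have k': "(w, v) \<in> E ^^ Suc k"
      using uv by auto
    have parity: "even i \<longleftrightarrow> even j" if "(w, x) \<in> E ^^ i" "(w, x) \<in> E ^^ j" for x i j
    proof -
      have "(w, w) \<in> E ^^ (i + j)"
        using that flip[OF that(2)] by (auto simp: relpow_add)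
      then show ?thesis
        using even_closed[of w "i + j"] by auto
    qed
    have "c u = (if even k then 0 else 1)" "c v = (if even (Suc k) then 0 else 1)"
      unfolding c_def using k k' parity by (metis)+
    then show ?thesis by simp
  qed
  ultimately show ?thesis
    using that by blast
qed

section \<open>Cyclic covers\<close>

text \<open>The derived graph of a voltage assignment \<open>d\<close> in \<int>/n, fixed only up to
  the bijection given by \<open>p\<close> and \<open>lev\<close>, so that copies and powers fit
  without renaming vertices. The edge clause applies to both orders of \<open>x\<close> and
  \<open>y\<close>, which makes \<open>d\<close> antisymmetric modulo \<open>n\<close> on the edges
  of a simple \<open>G\<close>.\<close>

definition cyclic_cover ::
  "nat \<Rightarrow> 'a sgraph \<Rightarrow> 'b sgraph \<Rightarrow> ('b \<Rightarrow> 'a) \<Rightarrow> ('b \<Rightarrow> nat) \<Rightarrow> ('a \<Rightarrow> 'a \<Rightarrow> int) \<Rightarrow> bool" where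
  "cyclic_cover n G H p lev d \<longleftrightarrow>
     bij_betw (\<lambda>x. (p x, lev x)) (verts H) (verts G \<times> {..<n}) \<and>
     (\<forall>e\<in>edges H. \<exists>x\<in>verts H. \<exists>y\<in>verts H. e = {x, y}) \<and>
     (\<forall>x\<in>verts H. \<forall>y\<in>verts H. {x, y} \<in> edges H \<longleftrightarrow>
        {p x, p y} \<in> edges G \<and> [int (lev y) = int (lev x) + d (p x) (p y)] (mod int n)) \<and>
     (\<forall>u v. {u, v} \<in> edges G \<longrightarrow> [2 * d u v = 1] (mod int n) \<or> [2 * d u v = -1] (mod int n))"

lemma cyclic_coverD:
  assumes "cyclic_cover n G H p lev d"
  shows cyclic_cover_bij: "bij_betw (\<lambda>x. (p x, lev x)) (verts H) (verts G \<times> {..<n})"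
    and cyclic_cover_edge_ends: "e \<in> edges H \<Longrightarrow> \<exists>x\<in>verts H. \<exists>y\<in>verts H. e = {x, y}"
    and cyclic_cover_edge_iff: "x \<in> verts H \<Longrightarrow> y \<in> verts H \<Longrightarrow> {x, y} \<in> edges H \<longleftrightarrow>
      {p x, p y} \<in> edges G \<and> [int (lev y) = int (lev x) + d (p x) (p y)] (mod int n)"
    and cyclic_cover_voltage: "{u, v} \<in> edges G \<Longrightarrow>
      [2 * d u v = 1] (mod int n) \<or> [2 * d u v = -1] (mod int n)"
  using assms by (simp_all add: cyclic_cover_def)

section \<open>Covers of disjoint sums\<close>

lemma edge_disjoint_sum_iff:
  "{x, y} \<in> edges (disjoint_sum I G) \<longleftrightarrow>
     fst x \<in> I \<and> fst x = fst y \<and> {snd x, snd y} \<in> edges (G (fst x))"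
proof -
  have 1: "e = {snd x, snd y} \<and> fst x = i \<and> fst y = i" if "{x, y} = Pair i ` e" for i e
  proof -
    have "snd ` {x, y} = e" "fst ` {x, y} \<subseteq> {i}"
      unfolding that by (auto simp: image_image)
    then show ?thesis by auto
  qed
  have 2: "{x, y} = Pair (fst x) ` {snd x, snd y}" if "fst x = fst y"
    using that by (auto simp: prod_eq_iff)
  show ?thesis
    unfolding disjoint_sum_def sgraph.sel UN_iff image_iff
    by (metis 1 2)
qed

lemma edge_disjoint_plus_iff [simp]:
  "{Inl x, Inl y} \<in> edges (disjoint_plus G H) \<longleftrightarrow> {x, y} \<in> edges G"
  "{Inr x', Inr y'} \<in> edges (disjoint_plus G H) \<longleftrightarrow> {x', y'} \<in> edges H"
  "{Inl x, Inr y'} \<notin> edges (disjoint_plus G H)"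
  "{Inr x', Inl y} \<notin> edges (disjoint_plus G H)"
proof -
  have 1: "Inl ` {x, y} = {Inl x, Inl y}" "Inr ` {x', y'} = {Inr x', Inr y'}"
    by auto
  show "{Inl x, Inl y} \<in> edges (disjoint_plus G H) \<longleftrightarrow> {x, y} \<in> edges G"
    unfolding disjoint_plus_def 1[symmetric]
    by (auto simp: image_iff inj_image_eq_iff simp del: image_insert)
  show "{Inr x', Inr y'} \<in> edges (disjoint_plus G H) \<longleftrightarrow> {x', y'} \<in> edges H"
    unfolding disjoint_plus_def 1[symmetric]
    by (auto simp: image_iff inj_image_eq_iff simp del: image_insert)
qed (auto simp: disjoint_plus_def)

lemma simple_graph_disjoint_sum:
  assumes "finite I" "\<And>i. i \<in> I \<Longrightarrow> simple_graph (G i)"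
  shows "simple_graph (disjoint_sum I G)"
  using assms
  by (fastforce simp: simple_graph_def disjoint_sum_def card_image inj_on_def)

text \<open>Covers of the components are chosen separately and glued as they are, since no edge
  joins two components.\<close>

lemma cyclic_cover_disjoint_sum:
  fixes I :: "'i set" and G :: "'i \<Rightarrow> 'a sgraph"
  assumes "J \<subseteq> I"
    and H: "\<And>i. i \<in> J \<Longrightarrow> \<exists>p lev d. cyclic_cover n (G i) (H i) p lev d"
    and K: "\<And>i. i \<in> I - J \<Longrightarrow> \<exists>p lev d. cyclic_cover n (G i) (K i) p lev d"
  shows "\<exists>p lev d. cyclic_cover n (disjoint_sum I G)
    (disjoint_plus (disjoint_sum J H) (disjoint_sum (I - J) K)) p lev d"
proof -
  obtain p lev d where H: "\<And>i. i \<in> J \<Longrightarrow> cyclic_cover n (G i) (H i) (p i) (lev i) (d i)"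
    using H by metis
  obtain p' lev' d' where K: "\<And>i. i \<in> I - J \<Longrightarrow> cyclic_cover n (G i) (K i) (p' i) (lev' i) (d' i)"
    using K by metis
  define P where "P = case_sum (\<lambda>(i, x). (i, p i x)) (\<lambda>(i, x). (i, p' i x))"
  define Lev where "Lev = case_sum (\<lambda>(i, x). lev i x) (\<lambda>(i, x). lev' i x)"
  \<comment> \<open>Both ends of an edge have the same index, so the first one decides which voltage
    applies.\<close>
  define D :: "'i \<times> 'a \<Rightarrow> 'i \<times> 'a \<Rightarrow> int"
    where "D = (\<lambda>(i, u) (_, v). if i \<in> J then d i u v else d' i u v)"
  let ?G = "disjoint_sum I G"
  let ?H = "disjoint_plus (disjoint_sum J H) (disjoint_sum (I - J) K)"
  have vG: "verts ?G = (SIGMA i:I. verts (G i))"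
    by (simp add: disjoint_sum_def)
  have vH: "verts ?H = (SIGMA i:J. verts (H i)) <+> (SIGMA i:I-J. verts (K i))"
    by (simp add: disjoint_sum_def disjoint_plus_def)
  note bH = cyclic_cover_bij[OF H] and bK = cyclic_cover_bij[OF K]
  note eH = cyclic_cover_edge_iff[OF H] and eK = cyclic_cover_edge_iff[OF K]
  note dH = cyclic_cover_voltage[OF H] and dK = cyclic_cover_voltage[OF K]
  have "inj_on (\<lambda>x. (P x, Lev x)) (verts ?H)"
    using bH bK unfolding vH P_def Lev_def bij_betw_def inj_on_def by fastforce
  moreover have "(\<lambda>x. (P x, Lev x)) ` verts ?H = verts ?G \<times> {..<n}"
  proof (intro subset_antisym subsetI)
    fix z assume "z \<in> (\<lambda>x. (P x, Lev x)) ` verts ?H"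
    then show "z \<in> verts ?G \<times> {..<n}"
      using bH bK assms(1) unfolding vH vG P_def Lev_def bij_betw_def by fastforce
  next
    fix z assume "z \<in> verts ?G \<times> {..<n}"
    then obtain i u t where z: "z = ((i, u), t)" "i \<in> I" "(u, t) \<in> verts (G i) \<times> {..<n}"
      unfolding vG by auto
    show "z \<in> (\<lambda>x. (P x, Lev x)) ` verts ?H"
    proof (cases "i \<in> J")
      case True
      then obtain x where "x \<in> verts (H i)" "(u, t) = (p i x, lev i x)"
        using bH z(3) unfolding bij_betw_def by blast
      then show ?thesis
        using True z by (intro image_eqI[of _ _ "Inl (i, x)"]) (auto simp: P_def Lev_def vH)
    next
      case False
      then obtain x where "x \<in> verts (K i)" "(u, t) = (p' i x, lev' i x)"
        using bK z(2,3) unfolding bij_betw_def by blast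
      then show ?thesis
        using False z by (intro image_eqI[of _ _ "Inr (i, x)"]) (auto simp: P_def Lev_def vH)
    qed
  qed
  moreover have "\<exists>x\<in>verts ?H. \<exists>y\<in>verts ?H. e = {x, y}" if e: "e \<in> edges ?H" for e
  proof -
    consider i e' where "i \<in> J" "e' \<in> edges (H i)" "e = Inl ` Pair i ` e'"
      | i e' where "i \<in> I - J" "e' \<in> edges (K i)" "e = Inr ` Pair i ` e'"
      using e by (auto simp: disjoint_plus_def disjoint_sum_def)
    then show ?thesis
    proof cases
      case 1
      then obtain x y where "x \<in> verts (H i)" "y \<in> verts (H i)" "e' = {x, y}"
        using cyclic_cover_edge_ends[OF H] by metis
      then show ?thesis
        using 1 unfolding vH
        by (intro bexI[of _ "Inl (i, x)"] bexI[of _ "Inl (i, y)"]) auto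
    next
      case 2
      then obtain x y where "x \<in> verts (K i)" "y \<in> verts (K i)" "e' = {x, y}"
        using cyclic_cover_edge_ends[OF K] by metis
      then show ?thesis
        using 2 unfolding vH
        by (intro bexI[of _ "Inr (i, x)"] bexI[of _ "Inr (i, y)"]) auto
    qed
  qed
  moreover have "{x, y} \<in> edges ?H \<longleftrightarrow>
      {P x, P y} \<in> edges ?G \<and> [int (Lev y) = int (Lev x) + D (P x) (P y)] (mod int n)"
    if "x \<in> verts ?H" "y \<in> verts ?H" for x y
    using that eH eK assms(1) unfolding vH
    by (auto simp: P_def Lev_def D_def edge_disjoint_sum_iff)
  moreover have "[2 * D u v = 1] (mod int n) \<or> [2 * D u v = -1] (mod int n)"
    if "{u, v} \<in> edges ?G" for u v
    using that dH dK
    by (cases u; cases v; cases "fst u \<in> J") (auto simp: D_def edge_disjoint_sum_iff)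
  ultimately show ?thesis
    unfolding cyclic_cover_def bij_betw_def by (intro exI[of _ P] exI[of _ Lev] exI[of _ D]) blast
qed

section \<open>Blowing up labels to blocks\<close>

lemma bij_betw_Plus_Times:
  assumes "bij_betw (\<lambda>x. (p x, l x)) A (A' \<times> N)" "bij_betw (\<lambda>x. (q x, m x)) B (B' \<times> N)"
  shows "bij_betw (\<lambda>z. (map_sum p q z, case_sum l m z)) (A <+> B) ((A' <+> B') \<times> N)"
proof -
  have "inj_on (\<lambda>z. (map_sum p q z, case_sum l m z)) (A <+> B)"
    using bij_betw_imp_inj_on[OF assms(1)] bij_betw_imp_inj_on[OF assms(2)]
    by (auto intro!: inj_onI elim!: PlusE dest: inj_onD)
  moreover have "(\<lambda>z. (map_sum p q z, case_sum l m z)) ` (A <+> B) = (A' <+> B') \<times> N"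
  proof (intro subset_antisym subsetI)
    fix z assume "z \<in> (\<lambda>z. (map_sum p q z, case_sum l m z)) ` (A <+> B)"
    then show "z \<in> (A' <+> B') \<times> N"
      using bij_betwE[OF assms(1)] bij_betwE[OF assms(2)] by auto
  next
    fix z assume "z \<in> (A' <+> B') \<times> N"
    then consider a t where "z = (Inl a, t)" "(a, t) \<in> A' \<times> N" | b t where "z = (Inr b, t)" "(b, t) \<in> B' \<times> N"
      by auto
    then show "z \<in> (\<lambda>z. (map_sum p q z, case_sum l m z)) ` (A <+> B)"
    proof cases
      case 1
      then obtain x where "x \<in> A" "(a, t) = (p x, l x)"
        using assms(1) unfolding bij_betw_def by blast
      then show ?thesis
        using 1 by (intro image_eqI[of _ _ "Inl x"]) auto
    next
      case 2
      then obtain x where "x \<in> B" "(b, t) = (q x, m x)"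
        using assms(2) unfolding bij_betw_def by blast
      then show ?thesis
        using 2 by (intro image_eqI[of _ _ "Inr x"]) auto
    qed
  qed
  ultimately show ?thesis
    by (simp add: bij_betw_def)
qed

text \<open>The label \<open>F a\<close> becomes the block of \<open>n\<close> labels ending at
  \<open>n * F a\<close>, in which \<open>L\<close> gives the position. Division with remainder
  yields injectivity, and counting does the rest. The lemma serves for vertices and edges together
  and for vertices alone.\<close>

lemma bij_betw_blocks:
  fixes F :: "'a \<Rightarrow> nat" and L :: "'b \<Rightarrow> nat"
  assumes F: "bij_betw F A {1..N}" and PL: "bij_betw (\<lambda>b. (P b, L b)) B (A \<times> {..<n})"
  shows "bij_betw (\<lambda>b. n * (F (P b) - 1) + L b + 1) B {1..n * N}"
proof -
  let ?h = "\<lambda>(a, t). n * (F a - 1) + t + 1"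
  have F1: "1 \<le> F a" "F a \<le> N" if "a \<in> A" for a
    using F that by (auto dest: bij_betwE)
  have "inj_on ?h (A \<times> {..<n})"
  proof (rule inj_onI; clarify)
    fix a t b u assume *: "a \<in> A" "t < n" "b \<in> A" "u < n"
      "n * (F a - 1) + t + 1 = n * (F b - 1) + u + 1"
    have "(n * q + r) div n = q" "(n * q + r) mod n = r" if "r < n" for q r
      using that by auto
    then have "F a - 1 = F b - 1" "t = u"
      using * by (metis add_right_cancel)+
    then have "F a = F b"
      using F1[OF *(1)] F1[OF *(3)] by simp
    then show "a = b \<and> t = u"
      using F * \<open>t = u\<close> by (auto simp: bij_betw_def inj_on_def)
  qed
  moreover have "?h ` (A \<times> {..<n}) \<subseteq> {1..n * N}"
  proof clarify
    fix a t assume *: "a \<in> A" "t < n"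
    have "n * (F a - 1) + t + 1 \<le> n * (F a - 1) + n"
      using * by simp
    also have "\<dots> = n * F a"
      using F1[OF *(1)] by (cases "F a") auto
    also have "\<dots> \<le> n * N"
      using F1[OF *(1)] by simp
    finally show "n * (F a - 1) + t + 1 \<in> {1..n * N}"
      by simp
  qed
  moreover have "card (A \<times> {..<n}) = card {1..n * N}"
    using bij_betw_same_card[OF F] by (simp add: card_cartesian_product)
  ultimately have "bij_betw ?h (A \<times> {..<n}) {1..n * N}"
    unfolding bij_betw_def by (metis card_image card_subset_eq finite_atLeastAtMost)
  from bij_betw_trans[OF PL this] show ?thesis
    by (simp add: comp_def)
qed

lemma bij_betw_card_eqI:
  assumes "inj_on f A" "f ` A \<subseteq> B" "card A = card B" "finite B"
  shows "bij_betw f A B"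
  using assms card_image[OF assms(1)] card_subset_eq[OF assms(4,2)] by (simp add: bij_betw_def)

section \<open>Level sums of the edges of a cover\<close>

text \<open>Doubling the congruence gives \<open>2 * (b - a) = e + (2 * k + 1) * z\<close> with
  \<open>e\<close> equal to 1 or -1. The range of the levels leaves -1, 0 and 1 for
  \<open>z\<close>, and parity excludes 0, so the levels differ by \<open>k\<close> or
  \<open>k + 1\<close>. Two numbers from 0 to \<open>2 * k\<close> that far apart have a sum between
  \<open>k\<close> and \<open>3 * k\<close>.\<close>

lemma level_sum_bounds:
  fixes a b k :: nat
  assumes "a < 2 * k + 1" "b < 2 * k + 1" "[int b = int a + d] (mod int (2 * k + 1))"
    and "[2 * d = 1] (mod int (2 * k + 1)) \<or> [2 * d = -1] (mod int (2 * k + 1))"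
  shows "k \<le> a + b" "a + b \<le> 3 * k"
proof -
  obtain e :: int where e: "e = 1 \<or> e = -1" "[2 * d = e] (mod int (2 * k + 1))"
    using assms(4) by blast
  have "[2 * int b = 2 * (int a + d)] (mod int (2 * k + 1))"
    using assms(3) by (rule cong_scalar_left)
  also have "2 * (int a + d) = 2 * int a + 2 * d"
    by simp
  also have "[2 * int a + 2 * d = 2 * int a + e] (mod int (2 * k + 1))"
    using e by (intro cong_add) auto
  finally obtain z where "2 * int b - (2 * int a + e) = int (2 * k + 1) * z"
    unfolding cong_iff_dvd_diff by blast
  then have z: "2 * int b - 2 * int a = e + int (2 * k + 1) * z"
    by simp
  have "\<not> 2 \<le> z"
  proof
    assume "2 \<le> z"
    then have "int (2 * k + 1) * 2 \<le> int (2 * k + 1) * z"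
      by (intro mult_left_mono) auto
    then show False
      using z e assms(1,2) by auto
  qed
  moreover have "\<not> z \<le> -2"
  proof
    assume "z \<le> -2"
    then have "int (2 * k + 1) * z \<le> int (2 * k + 1) * (-2)"
      by (intro mult_left_mono) auto
    then show False
      using z e assms(1,2) by auto
  qed
  moreover have "z \<noteq> 0"
  proof
    assume "z = 0"
    then have "2 * (int b - int a) = e"
      using z by simp
    then show False
      using e(1) by presburger
  qed
  ultimately have "z = 1 \<or> z = -1" by linarith
  then show "k \<le> a + b" "a + b \<le> 3 * k"
    using z e assms(1,2) by auto
qed

lemma cong_int_less_imp_eq:
  assumes "[int a = int b] (mod int n)" "a < n" "b < n"
  shows "a = b"
  using assms by (simp add: cong_int_iff cong_less_modulus_unique_nat)

text \<open>As \<open>G\<close> has no loops, the ends of \<open>e\<close> are distinct, and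
  \<open>sum lev e\<close> really is the sum of two levels.\<close>

lemma cyclic_cover_edge:
  assumes "simple_graph G" "cyclic_cover (2 * k + 1) G H p lev d" "e \<in> edges H"
  obtains x y where "e = {x, y}" "x \<noteq> y" "x \<in> verts H" "y \<in> verts H" "{p x, p y} \<in> edges G"
    "[int (lev y) = int (lev x) + d (p x) (p y)] (mod int (2 * k + 1))"
    "k \<le> lev x + lev y" "lev x + lev y \<le> 3 * k"
proof -
  obtain x y where xy: "e = {x, y}" "x \<in> verts H" "y \<in> verts H"
    using cyclic_cover_edge_ends[OF assms(2,3)] by auto
  have G: "{p x, p y} \<in> edges G"
    and c: "[int (lev y) = int (lev x) + d (p x) (p y)] (mod int (2 * k + 1))"
    using cyclic_cover_edge_iff[OF assms(2) xy(2,3)] assms(3) xy(1) by blast+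
  have "card {p x, p y} = 2"
    using assms(1) G by (simp add: simple_graph_def)
  then have "x \<noteq> y" by auto
  have lev: "lev x < 2 * k + 1" "lev y < 2 * k + 1"
    using bij_betwE[OF cyclic_cover_bij[OF assms(2)]] xy by blast+
  from that[OF xy(1) \<open>x \<noteq> y\<close> xy(2,3) G c
      level_sum_bounds[OF lev c cyclic_cover_voltage[OF assms(2) G]]] show ?thesis .
qed

text \<open>Over a fixed edge of \<open>G\<close> the level sum is
  \<open>2 * lev x + d (p x) (p y)\<close> modulo \<open>n\<close>; since 2 is invertible, it takes
  every residue exactly once. The values from \<open>k\<close> to \<open>3 * k\<close> form a full
  residue system, so the residue determines the sum, and \<open>3 * k - sum lev e\<close> counts the
  sums down from the top.\<close>

lemma cyclic_cover_edges_bij: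
  assumes G: "simple_graph G" and cover: "cyclic_cover (2 * k + 1) G H p lev d"
  shows "bij_betw (\<lambda>e. (p ` e, 3 * k - sum lev e)) (edges H) (edges G \<times> {..<2 * k + 1})"
proof -
  define n where "n = 2 * k + 1"
  note edge = cyclic_cover_edge[OF G cover, folded n_def]
  note bij = cyclic_cover_bij[OF cover, folded n_def]
  note iff = cyclic_cover_edge_iff[OF cover, folded n_def]
  note voltage = cyclic_cover_voltage[OF cover, folded n_def]
  have inj: "x = y" if "x \<in> verts H" "y \<in> verts H" "p x = p y" "lev x = lev y" for x y
    using inj_onD[OF bij_betw_imp_inj_on[OF bij]] that by simp
  have lev: "lev x < n" if "x \<in> verts H" for x
    using bij_betwE[OF bij] that by simp
  have "inj_on (\<lambda>e. (p ` e, 3 * k - sum lev e)) (edges H)"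
  proof (rule inj_onI, clarify)
    fix e e' assume e: "e \<in> edges H" "e' \<in> edges H" "p ` e = p ` e'"
      and sums: "3 * k - sum lev e = 3 * k - sum lev e'"
    obtain x y where xy: "e = {x, y}" "x \<noteq> y" "x \<in> verts H" "y \<in> verts H"
      "[int (lev y) = int (lev x) + d (p x) (p y)] (mod int n)" "lev x + lev y \<le> 3 * k"
      by (rule edge[OF e(1)]) (rule that)
    \<comment> \<open>The ends of \<open>e'\<close> are named in the order that matches their
      projections with those of \<open>e\<close>, so that one voltage serves both edges.\<close>
    obtain x' y' where xy': "e' = {x', y'}" "x' \<noteq> y'" "x' \<in> verts H" "y' \<in> verts H"
      "p x' = p x" "p y' = p y"
      "lev x' + lev y' \<le> 3 * k"
    proof -
      obtain x' y' where *: "e' = {x', y'}" "x' \<noteq> y'" "x' \<in> verts H" "y' \<in> verts H"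
        "lev x' + lev y' \<le> 3 * k"
        by (rule edge[OF e(2)]) (rule that)
      have "{p x', p y'} = {p x, p y}"
        using e(3) *(1) xy(1) by simp
      then consider "p x' = p x" "p y' = p y" | "p y' = p x" "p x' = p y"
        by (auto simp: doubleton_eq_iff)
      then show ?thesis
      proof cases
        case 1
        then show ?thesis
          using that[of x' y'] * by blast
      next
        case 2
        moreover have "e' = {y', x'}" "lev y' + lev x' \<le> 3 * k"
          using * by auto
        ultimately show ?thesis
          using that[of y' x'] * by blast
      qed
    qed
    have c': "[int (lev y') = int (lev x') + d (p x) (p y)] (mod int n)"
      using iff[of x' y'] e(2) xy' by simp
    have s: "lev x + lev y = lev x' + lev y'"
      using sums xy xy' by simp
    have "[int (lev x) + (int (lev x) + d (p x) (p y)) = int (lev x) + int (lev y)] (mod int n)"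
      using cong_sym[OF xy(5)] by (intro cong_add) auto
    also have "int (lev x) + int (lev y) = int (lev x') + int (lev y')"
      using s by linarith
    also have "[\<dots> = int (lev x') + (int (lev x') + d (p x) (p y))] (mod int n)"
      using c' by (intro cong_add) auto
    finally have "[2 * int (lev x) = 2 * int (lev x')] (mod int n)"
      by (simp add: cong_iff_dvd_diff)
    moreover have "coprime 2 (int n)"
      by (simp add: n_def)
    ultimately have "[int (lev x) = int (lev x')] (mod int n)"
      by (metis cong_mult_lcancel)
    then have "lev x = lev x'"
      using lev[OF xy(3)] lev[OF xy'(3)] by (rule cong_int_less_imp_eq)
    then have "lev y = lev y'"
      using s by linarith
    have "x = x'" "y = y'"
      using inj[OF xy(3) xy'(3) xy'(5)[symmetric] \<open>lev x = lev x'\<close>]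
        inj[OF xy(4) xy'(4) xy'(6)[symmetric] \<open>lev y = lev y'\<close>] by blast+
    then show "e = e'"
      using xy(1) xy'(1) by blast
  qed
  moreover have "(\<lambda>e. (p ` e, 3 * k - sum lev e)) ` edges H = edges G \<times> {..<n}"
  proof (intro subset_antisym subsetI)
    fix z assume "z \<in> (\<lambda>e. (p ` e, 3 * k - sum lev e)) ` edges H"
    then obtain e where e: "e \<in> edges H" "z = (p ` e, 3 * k - sum lev e)"
      by auto
    obtain x y where "e = {x, y}" "x \<noteq> y" "{p x, p y} \<in> edges G" "k \<le> lev x + lev y"
      by (rule edge[OF e(1)]) (rule that)
    then show "z \<in> edges G \<times> {..<n}"
      using e(2) by (auto simp: n_def)
  next
    fix z assume "z \<in> edges G \<times> {..<n}"
    then obtain e0 t where z: "z = (e0, t)" "e0 \<in> edges G" "t < n"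
      by auto
    then have "card e0 = 2" "e0 \<subseteq> verts G"
      using G by (auto simp: simple_graph_def)
    then obtain u v where uv: "e0 = {u, v}" "u \<in> verts G" "v \<in> verts G"
      by (auto simp: card_2_iff)
    \<comment> \<open>The prescribed level sum is \<open>c\<close>. As \<open>k + 1\<close> is the
      inverse of 2 modulo \<open>2 * k + 1\<close>, the level \<open>i\<close> solves
      \<open>2 * i + d u v = c\<close> modulo \<open>n\<close>.\<close>
    define c where "c = 3 * k - t"
    define i where "i = nat ((int (k + 1) * (int c - d u v)) mod int n)"
    define j where "j = nat ((int i + d u v) mod int n)"
    have ij: "i < n" "j < n"
      by (simp_all add: i_def j_def nat_less_iff n_def)
    have i: "int i = (int (k + 1) * (int c - d u v)) mod int n"
      and j: "int j = (int i + d u v) mod int n"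
      by (simp_all add: i_def j_def n_def)
    obtain x where x: "x \<in> verts H" "p x = u" "lev x = i"
    proof -
      have "(u, i) \<in> (\<lambda>x. (p x, lev x)) ` verts H"
        using bij uv ij by (simp add: bij_betw_def)
      then show ?thesis using that by auto
    qed
    obtain y where y: "y \<in> verts H" "p y = v" "lev y = j"
    proof -
      have "(v, j) \<in> (\<lambda>x. (p x, lev x)) ` verts H"
        using bij uv ij by (simp add: bij_betw_def)
      then show ?thesis using that by auto
    qed
    have cj: "[int j = int i + d u v] (mod int n)"
      by (simp add: j cong_def)
    then have H: "{x, y} \<in> edges H"
      using iff[of x y] x y uv z by simp
    have volt: "[2 * d u v = 1] (mod int n) \<or> [2 * d u v = -1] (mod int n)"
      using voltage uv z by simp
    have bounds: "k \<le> i + j" "i + j \<le> 3 * k"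
      using level_sum_bounds[of i k j] ij cj volt by (auto simp: n_def)
    have ci: "[int i = int (k + 1) * (int c - d u v)] (mod int n)"
      by (simp add: i cong_def)
    have "[int i + int j = int i + (int i + d u v)] (mod int n)"
      using cj by (intro cong_add) auto
    also have "int i + (int i + d u v) = 2 * int i + d u v"
      by simp
    also have "[\<dots> = 2 * (int (k + 1) * (int c - d u v)) + d u v] (mod int n)"
      using ci by (intro cong_add cong_scalar_left) auto
    also have "2 * (int (k + 1) * (int c - d u v)) + d u v = int n * (int c - d u v) + int c"
      by (simp add: n_def algebra_simps)
    also have "[\<dots> = int c] (mod int n)"
      by (simp add: cong_def)
    \<comment> \<open>Subtracting \<open>k\<close> moves both sums into the range from 0 to
      \<open>2 * k\<close>, where congruent numbers are equal.\<close>
    finally have "[int (i + j - k) = int (c - k)] (mod int n)"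
      using bounds z(3) by (simp add: cong_iff_dvd_diff of_nat_diff c_def n_def algebra_simps)
    then have "i + j - k = c - k"
      using bounds z(3) by (intro cong_int_less_imp_eq[where n = n]) (auto simp: c_def n_def)
    then have "i + j = c"
      using bounds z(3) by (auto simp: c_def n_def)
    moreover have "x \<noteq> y"
      using x y uv \<open>card e0 = 2\<close> by auto
    ultimately have "3 * k - sum lev {x, y} = t"
      using x y z(3) by (simp add: c_def n_def)
    then show "z \<in> (\<lambda>e. (p ` e, 3 * k - sum lev e)) ` edges H"
      using x y uv z H by (intro image_eqI[of _ _ "{x, y}"]) auto
  qed
  ultimately show ?thesis
    by (simp add: bij_betw_def n_def)
qed

section \<open>Transfer of labelings to a cover\<close>

text \<open>Along an edge, the blocks contribute \<open>n * (K - 3)\<close> to the sum of the three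
  labels, and the levels of the ends cancel against the position \<open>3 * k - sum lev e\<close> of
  the edge. The same \<open>g\<close> works in the super case because the vertex labels fill the
  first blocks.\<close>

lemma cyclic_cover_labeling:
  assumes "odd n" and G: "simple_graph G" and "cyclic_cover n G H p lev d"
  shows "\<exists>g. (edge_magic_labeling G f \<longrightarrow> edge_magic_labeling H g) \<and>
             (super_edge_magic_labeling G f \<longrightarrow> super_edge_magic_labeling H g)"
proof -
  obtain k where n: "n = 2 * k + 1"
    using assms(1) by (elim oddE)
  have cover: "cyclic_cover (2 * k + 1) G H p lev d"
    using assms(3) n by simp
  define L where "L = case_sum lev (\<lambda>e. 3 * k - sum lev e)"
  define g where "g z = n * (f (map_sum p ((`) p) z) - 1) + L z + 1" for z
  have V: "bij_betw (\<lambda>x. (p x, lev x)) (verts H) (verts G \<times> {..<n})"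
    by (rule cyclic_cover_bij[OF assms(3)])
  have E: "bij_betw (\<lambda>e. (p ` e, 3 * k - sum lev e)) (edges H) (edges G \<times> {..<n})"
    using cyclic_cover_edges_bij[OF G cover] n by simp
  have VE: "bij_betw (\<lambda>z. (map_sum p ((`) p) z, L z)) (verts H <+> edges H) ((verts G <+> edges G) \<times> {..<n})"
    unfolding L_def by (rule bij_betw_Plus_Times[OF V E])
  have card: "card (verts H) = n * card (verts G)" "card (edges H) = n * card (edges G)"
    using bij_betw_same_card[OF V] bij_betw_same_card[OF E]
    by (simp_all add: card_cartesian_product)
  have em: "edge_magic_labeling H g" if f: "edge_magic_labeling G f"
  proof -
    have bij: "bij_betw f (verts G <+> edges G) {1..card (verts G) + card (edges G)}"
      using f by (simp add: edge_magic_labeling_def)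
    obtain K where K: "f (Inl u) + f (Inr {u, v}) + f (Inl v) = K" if "{u, v} \<in> edges G" for u v
      using f unfolding edge_magic_labeling_def by blast
    have pos: "f z \<noteq> 0" if "z \<in> verts G <+> edges G" for z
      using bij_betwE[OF bij] that by (metis atLeastAtMost_iff not_one_le_zero)
    have "bij_betw g (verts H <+> edges H) {1..card (verts H) + card (edges H)}"
      using bij_betw_blocks[OF bij VE] unfolding g_def card distrib_left .
    moreover have "g (Inl x) + g (Inr {x, y}) + g (Inl y) = n * (K - 3) + 3 * k + 3"
      if "{x, y} \<in> edges H" for x y
    proof -
      obtain x' y' where xy': "{x, y} = {x', y'}" "x' \<noteq> y'" "x' \<in> verts H" "y' \<in> verts H"
        "{p x', p y'} \<in> edges G" "lev x' + lev y' \<le> 3 * k"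
        by (rule cyclic_cover_edge[OF G cover \<open>{x, y} \<in> edges H\<close>]) (rule that)
      then have "x \<noteq> y" "{p x, p y} \<in> edges G" "lev x + lev y \<le> 3 * k"
        by (auto simp: doubleton_eq_iff insert_commute)
      moreover from this have "p x \<in> verts G" "p y \<in> verts G"
        using G by (auto simp: simple_graph_def)
      \<comment> \<open>Labels of \<open>G\<close> start at 1, so the truncated subtraction in
        \<open>g\<close> is exact on them.\<close>
      moreover obtain a b c where "f (Inl (p x)) = Suc a" "f (Inr {p x, p y}) = Suc b" "f (Inl (p y)) = Suc c"
        using calculation pos by (metis InlI InrI not0_implies_Suc)
      moreover have "Suc a + Suc b + Suc c = K"
        using K[of "p x" "p y"] calculation by metis
      then have "K - 3 = a + b + c"
        by simp
      ultimately show ?thesis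
        by (simp add: g_def L_def algebra_simps)
    qed
    ultimately show ?thesis
      unfolding edge_magic_labeling_def by blast
  qed
  have sem: "super_edge_magic_labeling H g" if f: "super_edge_magic_labeling G f"
  proof -
    have "inj_on f (verts G <+> edges G)" "f ` Inl ` verts G = {1..card (verts G)}"
      using f by (auto simp: super_edge_magic_labeling_def edge_magic_labeling_def bij_betw_def)
    then have "bij_betw (\<lambda>u. f (Inl u)) (verts G) {1..card (verts G)}"
      by (auto simp: bij_betw_def inj_on_def image_image)
    from bij_betw_blocks[OF this V] have "(\<lambda>x. g (Inl x)) ` verts H = {1..card (verts H)}"
      by (simp add: bij_betw_def g_def L_def card)
    then show ?thesis
      using em f by (simp add: super_edge_magic_labeling_def image_image)
  qed
  show ?thesis
    using em sem by blast
qed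

section \<open>Trivial covers from potentials\<close>

text \<open>Voltages that are differences of a potential \<open>s * P\<close> sum to 0 around every
  closed walk, so the cover splits into \<open>n\<close> sheets. Copy \<open>r\<close> is the sheet
  in which \<open>u\<close> has level \<open>r + s * P u\<close>.\<close>

lemma cyclic_cover_copies:
  fixes s :: int and P :: "'a \<Rightarrow> int"
  assumes "0 < n" and G: "simple_graph G" and s: "[2 * s = 1] (mod int n)"
    and P: "\<And>u v. {u, v} \<in> edges G \<Longrightarrow> [P v - P u = 1] (mod int n) \<or> [P v - P u = -1] (mod int n)"
  shows "cyclic_cover n G (copies n G) snd (\<lambda>(r, u). nat ((int r + s * P u) mod int n))
    (\<lambda>u v. s * (P v - P u))"
  (is "cyclic_cover n G ?H snd ?lev ?d")
proof -
  have vH: "verts ?H = {1..n} \<times> verts G"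
    by (simp add: copies_def disjoint_sum_def)
  have lev: "int (?lev x) = (int (fst x) + s * P (snd x)) mod int n" for x
    using assms(1) by (simp add: case_prod_beta)
  \<comment> \<open>The copies are numbered from 1; shifting by 1 makes them the standard
    residues.\<close>
  have copy_eq: "r = r'" if "[int r = int r'] (mod int n)" "r \<in> {1..n}" "r' \<in> {1..n}" for r r'
  proof -
    have "[int (r - 1) = int (r' - 1)] (mod int n)"
      using that by (simp add: cong_iff_dvd_diff of_nat_diff)
    then have "r - 1 = r' - 1"
      using that by (intro cong_int_less_imp_eq[where n = n]) auto
    then show ?thesis
      using that by auto
  qed
  \<comment> \<open>The potential cancels from the congruence, leaving only the comparison of the
    copies.\<close>
  have lev_cong: "[int (?lev y) = int (?lev x) + ?d (snd x) (snd y)] (mod int n) \<longleftrightarrow> fst x = fst y"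
    if "x \<in> verts ?H" "y \<in> verts ?H" for x y
  proof -
    have "[int (?lev y) = int (?lev x) + ?d (snd x) (snd y)] (mod int n) \<longleftrightarrow>
      [int (fst y) + s * P (snd y) = int (fst x) + s * P (snd x) + ?d (snd x) (snd y)] (mod int n)"
      unfolding lev by (simp add: cong_def mod_simps)
    also have "\<dots> \<longleftrightarrow> [int (fst y) = int (fst x)] (mod int n)"
      by (simp add: cong_iff_dvd_diff algebra_simps)
    also have "\<dots> \<longleftrightarrow> fst x = fst y"
      using copy_eq[of "fst y" "fst x"] that by (auto simp: vH)
    finally show ?thesis .
  qed
  have "inj_on (\<lambda>x. (snd x, ?lev x)) (verts ?H)"
  proof (rule inj_onI)
    fix x y assume "x \<in> verts ?H" "y \<in> verts ?H" "(snd x, ?lev x) = (snd y, ?lev y)"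
    \<comment> \<open>Between vertices with equal projections the voltage is 0, so
      \<open>lev_cong\<close> turns equal levels into equal copies.\<close>
    then show "x = y"
      using lev_cong[of x y] by (simp add: prod_eq_iff)
  qed
  moreover have "(\<lambda>x. (snd x, ?lev x)) ` verts ?H \<subseteq> verts G \<times> {..<n}"
    using assms(1) by (auto simp: vH nat_less_iff)
  moreover have "card (verts ?H) = card (verts G \<times> {..<n})"
    by (simp add: vH card_cartesian_product)
  moreover have "finite (verts G \<times> {..<n})"
    using G by (simp add: simple_graph_def)
  ultimately have "bij_betw (\<lambda>x. (snd x, ?lev x)) (verts ?H) (verts G \<times> {..<n})"
    by (rule bij_betw_card_eqI)
  moreover have "\<exists>x\<in>verts ?H. \<exists>y\<in>verts ?H. e = {x, y}" if "e \<in> edges ?H" for e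
  proof -
    obtain r e' where e: "r \<in> {1..n}" "e' \<in> edges G" "e = Pair r ` e'"
      using \<open>e \<in> edges ?H\<close> by (auto simp: copies_def disjoint_sum_def)
    then have "e' \<subseteq> verts G" "card e' = 2"
      using G by (auto simp: simple_graph_def)
    then obtain u v where "e' = {u, v}" "u \<in> verts G" "v \<in> verts G"
      by (auto simp: card_2_iff)
    then show ?thesis
      using e unfolding vH by (intro bexI[of _ "(r, u)"] bexI[of _ "(r, v)"]) auto
  qed
  moreover have "{x, y} \<in> edges ?H \<longleftrightarrow> {snd x, snd y} \<in> edges G \<and>
      [int (?lev y) = int (?lev x) + ?d (snd x) (snd y)] (mod int n)"
    if "x \<in> verts ?H" "y \<in> verts ?H" for x y
    unfolding lev_cong[OF that] copies_def edge_disjoint_sum_iff using that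
    by (auto simp: vH)
  moreover have "[2 * ?d u v = 1] (mod int n) \<or> [2 * ?d u v = -1] (mod int n)" if "{u, v} \<in> edges G" for u v
  proof -
    have "2 * ?d u v = 2 * s * (P v - P u)"
      by simp
    then show ?thesis
      using P[OF that] cong_mult[OF s, of "P v - P u" 1] cong_mult[OF s, of "P v - P u" "-1"]
      by (auto simp: mult.assoc)
  qed
  ultimately show ?thesis
    unfolding cyclic_cover_def by blast
qed

section \<open>Covers of unicyclic graphs\<close>

lemma verts_unicyclic_graph:
  "verts (unicyclic_graph ts) = (SIGMA j:{..<length ts}. verts (fst (ts ! j)))"
  by (simp add: unicyclic_graph_def disjoint_sum_def Let_def)

text \<open>A set of two vertices carries no orientation, hence a cycle edge is listed in both
  directions.\<close>

lemma edge_unicyclic_graph_iff: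
  "{x, y} \<in> edges (unicyclic_graph ts) \<longleftrightarrow>
     (fst x < length ts \<and> fst x = fst y \<and> {snd x, snd y} \<in> edges (fst (ts ! fst x))) \<or>
     (fst x < length ts \<and> fst y < length ts \<and> snd x = snd (ts ! fst x) \<and> snd y = snd (ts ! fst y) \<and>
      (fst y = Suc (fst x) mod length ts \<or> fst x = Suc (fst y) mod length ts))"
proof -
  have Suc_mod: "Suc j mod length ts < length ts" if "j < length ts" for j
    using that by (intro mod_less_divisor) auto
  have "{x, y} \<in> cycle_edges ts \<longleftrightarrow>
    fst x < length ts \<and> fst y < length ts \<and> snd x = snd (ts ! fst x) \<and> snd y = snd (ts ! fst y) \<and>
      (fst y = Suc (fst x) mod length ts \<or> fst x = Suc (fst y) mod length ts)"
    using Suc_mod[of "fst x"] Suc_mod[of "fst y"]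
    by (cases x; cases y) (auto simp: cycle_edges_def Let_def doubleton_eq_iff)
  then show ?thesis
    by (simp add: unicyclic_graph_def Let_def edge_disjoint_sum_iff)
qed

lemma unicyclic_graph_edge_ends:
  assumes "unicyclic ts" "e \<in> edges (unicyclic_graph ts)"
  obtains x y where "e = {x, y}" "x \<noteq> y" "x \<in> verts (unicyclic_graph ts)" "y \<in> verts (unicyclic_graph ts)"
proof -
  have ts: "tree (fst (ts ! j))" "snd (ts ! j) \<in> verts (fst (ts ! j))" if "j < length ts" for j
    using assms(1) nth_mem[OF that] by (auto simp: unicyclic_def)
  from assms(2) consider j e' where "j < length ts" "e' \<in> edges (fst (ts ! j))" "e = Pair j ` e'"
    | j where "j < length ts" "e = {(j, snd (ts ! j)), (Suc j mod length ts, snd (ts ! (Suc j mod length ts)))}"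
    by (auto simp: unicyclic_graph_def Let_def disjoint_sum_def cycle_edges_def)
  then show ?thesis
  proof cases
    case 1
    then have "e' \<subseteq> verts (fst (ts ! j))" "card e' = 2"
      using ts[of j] by (auto simp: tree_def simple_graph_def)
    then obtain u v where "e' = {u, v}" "u \<noteq> v" "u \<in> verts (fst (ts ! j))" "v \<in> verts (fst (ts ! j))"
      by (auto simp: card_2_iff)
    then show ?thesis
      using 1 that[of "(j, u)" "(j, v)"] by (auto simp: verts_unicyclic_graph)
  next
    case 2
    let ?i = "Suc j mod length ts"
    have "?i < length ts"
      using 2 by (intro mod_less_divisor) auto
    \<comment> \<open>On a cycle of length at least 3 no position is its own successor.\<close>
    moreover have "?i \<noteq> j"
      using assms(1) 2 by (auto simp: unicyclic_def mod_Suc)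
    ultimately show ?thesis
      using 2 ts by (intro that[of "(j, snd (ts ! j))" "(?i, snd (ts ! ?i))"]) (auto simp: verts_unicyclic_graph)
  qed
qed

lemma simple_graph_unicyclic_graph:
  assumes "unicyclic ts"
  shows "simple_graph (unicyclic_graph ts)"
proof -
  have "finite (verts (fst (ts ! j)))" if "j < length ts" for j
    using assms nth_mem[OF that] by (auto simp: unicyclic_def tree_def simple_graph_def)
  then have "finite (verts (unicyclic_graph ts))"
    by (auto simp: verts_unicyclic_graph)
  moreover have "e \<subseteq> verts (unicyclic_graph ts) \<and> card e = 2"
    if "e \<in> edges (unicyclic_graph ts)" for e
    by (rule unicyclic_graph_edge_ends[OF assms that]) simp
  ultimately show ?thesis
    by (simp add: simple_graph_def)
qed

text \<open>With value 0 at the roots, adding \<open>c\<close> extends a potential from the cycle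
  into the trees and leaves the cycle vertices unchanged.\<close>

lemma unicyclic_tree_colouring:
  assumes "unicyclic ts"
  obtains c :: "nat \<Rightarrow> 'a \<Rightarrow> int"
  where "\<And>j. j < length ts \<Longrightarrow> c j (snd (ts ! j)) = 0"
    "\<And>j u v. j < length ts \<Longrightarrow> {u, v} \<in> edges (fst (ts ! j)) \<Longrightarrow> c j v - c j u = 1 \<or> c j v - c j u = -1"
proof -
  have "\<exists>c :: 'a \<Rightarrow> int. c (snd (ts ! j)) = 0 \<and>
      (\<forall>u v. {u, v} \<in> edges (fst (ts ! j)) \<longrightarrow> c v - c u = 1 \<or> c v - c u = -1)" if "j < length ts" for j
  proof -
    have "tree (fst (ts ! j))" "snd (ts ! j) \<in> verts (fst (ts ! j))"
      using assms nth_mem[OF that] by (auto simp: unicyclic_def)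
    then obtain c :: "'a \<Rightarrow> int" where c: "c (snd (ts ! j)) = 0"
      "\<And>u v. {u, v} \<in> edges (fst (ts ! j)) \<Longrightarrow> \<bar>c v - c u\<bar> = 1"
      using tree_bipartite by metis
    have "c v - c u = 1 \<or> c v - c u = -1" if "{u, v} \<in> edges (fst (ts ! j))" for u v
      using c(2)[OF that] by linarith
    then show ?thesis
      using c(1) by blast
  qed
  then show ?thesis
    using that by metis
qed

section \<open>Copies of a unicyclic graph as a cover\<close>

text \<open>The potential is \<open>a\<close> on the cycle plus the tree colouring. An even cycle
  alternates between 0 and 1. An odd one cannot, so its potential winds once around \<int>/n, for
  which the cycle must have at least \<open>n\<close> edges.\<close>

lemma unicyclic_cover_copies:
  assumes "odd n" and ts: "unicyclic ts" and long: "odd (length ts) \<Longrightarrow> n \<le> length ts"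
  shows "\<exists>p lev d. cyclic_cover n (unicyclic_graph ts) (copies n (unicyclic_graph ts)) p lev d"
proof -
  let ?m = "length ts"
  obtain c where c: "\<And>j. j < ?m \<Longrightarrow> c j (snd (ts ! j)) = (0::int)"
    "\<And>j u v. j < ?m \<Longrightarrow> {u, v} \<in> edges (fst (ts ! j)) \<Longrightarrow> c j v - c j u = 1 \<or> c j v - c j u = -1"
    using unicyclic_tree_colouring[OF ts] by blast
  \<comment> \<open>For odd length, climbing from 0 to \<open>n - 1\<close> and stepping back to 0 uses up \<open>n\<close> steps \<open>+1\<close> modulo \<open>n\<close>.
    The remaining even number of steps alternates.\<close>
  define a :: "nat \<Rightarrow> int" where
    "a j = (if even ?m then int (j mod 2) else if j < n then int j else int ((j - n) mod 2))" for j
  have a: "[a (Suc j mod ?m) - a j = 1] (mod int n) \<or> [a (Suc j mod ?m) - a j = -1] (mod int n)"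
    if j: "j < ?m" for j
  proof (cases "even ?m")
    case True
    then have "Suc j mod ?m mod 2 = Suc j mod 2"
      by (simp add: mod_mod_cancel)
    then have "a (Suc j mod ?m) - a j = 1 \<or> a (Suc j mod ?m) - a j = -1"
      using True by (cases "even j") (auto simp: a_def mod_Suc elim!: evenE oddE)
    then show ?thesis by auto
  next
    case False
    \<comment> \<open>The step from \<open>n - 1\<close> back to 0 counts as +1 modulo
      \<open>n\<close>.\<close>
    have wrap: "[- int (n - 1) = 1] (mod int n)"
      using odd_pos[OF \<open>odd n\<close>] by (simp add: cong_iff_dvd_diff of_nat_diff)
    have n: "n \<le> ?m" "0 < n"
      using long False \<open>odd n\<close> by (auto intro: odd_pos)
    consider "Suc j < n" | "Suc j = n" | "n \<le> j" "Suc j < ?m" | "n \<le> j" "Suc j = ?m"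
      using j by linarith
    then show ?thesis
    proof cases
      case 1
      then have "a (Suc j mod ?m) - a j = 1"
        using False n by (simp add: a_def)
      then show ?thesis by simp
    next
      case 2
      \<comment> \<open>The next position is \<open>n\<close>, where the alternating part starts, or
        0 if \<open>n\<close> is the whole length; \<open>a\<close> vanishes at both.\<close>
      have "a (Suc j mod ?m) = 0"
        using 2 False n by (cases "n = ?m") (auto simp: a_def)
      moreover have "a j = int (n - 1)"
        using 2 False by (auto simp: a_def)
      ultimately show ?thesis
        using wrap by simp
    next
      case 3
      then have "a (Suc j mod ?m) - a j = 1 \<or> a (Suc j mod ?m) - a j = -1"
        using False by (auto simp: a_def Suc_diff_le mod_Suc)
      then show ?thesis by auto
    next
      case 4
      then have "Suc (j - n) = ?m - n"
        by simp
      \<comment> \<open>The alternating part has even length, so it ends with the value 1 and the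
        closing edge steps down to 0.\<close>
      moreover have "even (?m - n)"
        using False \<open>odd n\<close> by simp
      ultimately have "(j - n) mod 2 = 1"
        by (metis even_Suc odd_iff_mod_2_eq_one)
      then have "a (Suc j mod ?m) - a j = -1"
        using False n 4 by (simp add: a_def)
      then show ?thesis by simp
    qed
  qed
  define P where "P = (\<lambda>(j, v). a j + c j v)"
  have flip: "[u - v = 1] (mod int n) \<or> [u - v = -1] (mod int n)"
    if "[v - u = 1] (mod int n) \<or> [v - u = -1] (mod int n)" for u v
    using that cong_minus_minus_iff[of "v - u" 1 "int n"] cong_minus_minus_iff[of "v - u" "-1" "int n"]
    by auto
  have P: "[P y - P x = 1] (mod int n) \<or> [P y - P x = -1] (mod int n)"
    if "{x, y} \<in> edges (unicyclic_graph ts)" for x y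
    using that unfolding edge_unicyclic_graph_iff
  proof (elim disjE conjE)
    assume "fst x < ?m" "fst x = fst y" "{snd x, snd y} \<in> edges (fst (ts ! fst x))"
    then have "P y - P x = 1 \<or> P y - P x = -1"
      using c(2)[of "fst x" "snd x" "snd y"] by (auto simp: P_def case_prod_beta)
    then show ?thesis by auto
  next
    assume "fst x < ?m" "fst y < ?m" "snd x = snd (ts ! fst x)" "snd y = snd (ts ! fst y)"
      "fst y = Suc (fst x) mod ?m"
    then show ?thesis
      using a[of "fst x"] c(1)[of "fst x"] c(1)[of "fst y"] by (simp add: P_def case_prod_beta)
  next
    assume "fst x < ?m" "fst y < ?m" "snd x = snd (ts ! fst x)" "snd y = snd (ts ! fst y)"
      "fst x = Suc (fst y) mod ?m"
    then show ?thesis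
      using flip[OF a[of "fst y"]] c(1)[of "fst x"] c(1)[of "fst y"] by (simp add: P_def case_prod_beta)
  qed
  have "[2 * int ((n + 1) div 2) = 1] (mod int n)"
    using \<open>odd n\<close> by (elim oddE) (auto simp: cong_iff_dvd_diff)
  from cyclic_cover_copies[where P = P, OF odd_pos[OF \<open>odd n\<close>] simple_graph_unicyclic_graph[OF ts] this P]
  show ?thesis by (intro exI)
qed

section \<open>The power of a unicyclic graph as a cover\<close>

lemma length_unicyclic_power [simp]: "length (unicyclic_power ts n) = length ts * n"
  by (induction n) (simp_all add: unicyclic_power_def)

lemma nth_unicyclic_power:
  "j < length ts * n \<Longrightarrow> unicyclic_power ts n ! j = ts ! (j mod length ts)"
proof (induction n arbitrary: j)
  case (Suc n)
  then show ?case
    by (cases "j < length ts") (auto simp: unicyclic_power_def nth_append le_mod_geq)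
qed simp

lemma unicyclic_power_unicyclic:
  assumes "unicyclic ts" "0 < n"
  shows "unicyclic (unicyclic_power ts n)"
proof -
  have "3 * 1 \<le> length ts * n"
    using assms by (intro mult_le_mono) (auto simp: unicyclic_def)
  then show ?thesis
    using assms(1) by (auto simp: unicyclic_def[of "unicyclic_power ts n"])
      (auto simp: unicyclic_power_def unicyclic_def)
qed

text \<open>Index \<open>i\<close> is the position \<open>i mod m\<close> in the block
  \<open>i div m\<close>. A step advances the position like the last digit of an odometer and
  carries into the block, counted modulo \<open>n\<close>, when the position wraps round.\<close>

lemma Suc_mod_mult_iff:
  fixes m n i j :: nat
  assumes "0 < m" "i < m * n" "j < m * n"
  shows "j = Suc i mod (m * n) \<longleftrightarrow> j mod m = Suc (i mod m) mod m \<and>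
    [int (j div m) = int (i div m) + (if Suc (i mod m) = m then 1 else 0)] (mod int n)"
proof -
  have "Suc i mod (m * n) = m * (Suc i div m mod n) + Suc i mod m"
    by (rule mod_mult2_eq)
  moreover have "j = m * (j div m) + j mod m"
    by simp
  ultimately have "j = Suc i mod (m * n) \<longleftrightarrow>
      m * (j div m) + j mod m = m * (Suc i div m mod n) + Suc i mod m"
    by simp
  also have "\<dots> \<longleftrightarrow> j mod m = Suc i mod m \<and> j div m = Suc i div m mod n"
  proof
    assume *: "m * (j div m) + j mod m = m * (Suc i div m mod n) + Suc i mod m"
    have "(m * q + r) div m = q" "(m * q + r) mod m = r" if "r < m" for q r
      using that by auto
    then show "j mod m = Suc i mod m \<and> j div m = Suc i div m mod n"
      using * assms(1) by (metis mod_less_divisor)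
  qed simp
  also have "j div m < n"
    using assms(3) by (simp add: less_mult_imp_div_less mult.commute)
  then have "j div m = Suc i div m mod n \<longleftrightarrow> [int (j div m) = int (Suc i div m)] (mod int n)"
    by (simp add: cong_int_iff) (simp add: cong_def)
  also have "Suc i div m = i div m + (if Suc (i mod m) = m then 1 else 0)"
    using assms(1) by (simp add: div_Suc mod_Suc)
  finally show ?thesis
    by (simp add: mod_Suc_eq)
qed

text \<open>The voltages around the cycle add up to \<open>s * t\<close>, a unit modulo
  \<open>n\<close>, so the cycle lifts to a single cycle of length \<open>m * n\<close>. In the
  levels, passing to the next block adds \<open>s * t\<close>, and \<open>P\<close> accounts for the
  steps inside a block.\<close>

lemma unicyclic_cover_power:
  assumes "odd n" and ts: "unicyclic ts"
  shows "\<exists>p lev d. cyclic_cover n (unicyclic_graph ts) (unicyclic_graph (unicyclic_power ts n)) p lev d"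
proof -
  define m where "m = length ts"
  let ?G = "unicyclic_graph ts" and ?H = "unicyclic_graph (unicyclic_power ts n)"
  obtain c where c: "\<And>j. j < m \<Longrightarrow> c j (snd (ts ! j)) = (0::int)"
    "\<And>j u v. j < m \<Longrightarrow> {u, v} \<in> edges (fst (ts ! j)) \<Longrightarrow> c j v - c j u = 1 \<or> c j v - c j u = -1"
    using unicyclic_tree_colouring[OF ts] unfolding m_def by blast
  have m: "3 \<le> m" and n: "0 < n"
    using ts odd_pos[OF \<open>odd n\<close>] by (auto simp: unicyclic_def m_def)
  \<comment> \<open>The sum of the signs around the cycle is \<open>t\<close>: they alternate up to the closing edge, whose sign is \<open>+1\<close>.\<close>
  define t :: int where "t = (if odd m then 1 else 2)"
  define s :: int where "s = int ((n + 1) div 2)"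
  define P where "P = (\<lambda>(j, v). int (j mod 2) + c j v)"
  \<comment> \<open>The signed crossing of the closing edge, from position \<open>m - 1\<close> to
    position 0; it records when the block changes.\<close>
  define W :: "nat \<Rightarrow> nat \<Rightarrow> int" where
    "W i j = (if j = 0 \<and> Suc i = m then 1 else if i = 0 \<and> Suc j = m then -1 else 0)" for i j
  define p :: "nat \<times> 'a \<Rightarrow> nat \<times> 'a" where "p x = (fst x mod m, snd x)" for x
  define lev where "lev x = nat ((s * (t * int (fst x div m) + P (p x))) mod int n)" for x
  define d where "d x y = s * (P y - P x + t * W (fst x) (fst y))" for x y
  have s: "[2 * s = 1] (mod int n)"
    unfolding s_def using \<open>odd n\<close> by (elim oddE) (auto simp: cong_iff_dvd_diff)
  then have "coprime s (int n)"
    by (metis coprime_iff_invertible_int mult.commute)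
  moreover have t: "coprime t (int n)"
    using \<open>odd n\<close> by (simp add: t_def)
  ultimately have st: "coprime (s * t) (int n)"
    by simp
  have W_swap: "W j i = - W i j" for i j
    using m by (auto simp: W_def)
  have W_same: "W j j = 0" for j
    using m by (auto simp: W_def)
  have W_Suc: "W i (Suc i mod m) = (if Suc i = m then 1 else 0)" if "i < m" for i
    using that m by (auto simp: W_def)
  have vH: "x \<in> verts ?H \<longleftrightarrow> fst x < m * n \<and> snd x \<in> verts (fst (ts ! (fst x mod m)))" for x
    by (cases x) (auto simp: verts_unicyclic_graph m_def nth_unicyclic_power)
  have lev: "int (lev x) = (s * (t * int (fst x div m) + P (p x))) mod int n" for x
    using n by (simp add: lev_def)
  \<comment> \<open>This is the congruence of levels after the potential has cancelled and the unit
    \<open>s * t\<close> has been divided out; only blocks and crossings remain.\<close>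
  define Q where "Q i j \<longleftrightarrow> [int (j div m) = int (i div m) + W (i mod m) (j mod m)] (mod int n)" for i j
  have lev_cong: "[int (lev y) = int (lev x) + d (p x) (p y)] (mod int n) \<longleftrightarrow> Q (fst x) (fst y)" for x y
  proof -
    have "[int (lev y) = int (lev x) + d (p x) (p y)] (mod int n) \<longleftrightarrow>
      [s * (t * int (fst y div m) + P (p y)) = s * (t * int (fst x div m) + P (p x)) + d (p x) (p y)] (mod int n)"
      unfolding lev by (simp add: cong_def mod_simps)
    also have "\<dots> \<longleftrightarrow> [s * t * int (fst y div m) =
        s * t * (int (fst x div m) + W (fst x mod m) (fst y mod m))] (mod int n)"
      by (simp add: cong_iff_dvd_diff d_def p_def algebra_simps)
    also have "\<dots> \<longleftrightarrow> Q (fst x) (fst y)"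
      unfolding Q_def by (rule cong_mult_lcancel[OF st])
    finally show ?thesis .
  qed
  have div_less: "i div m < n" if "i < m * n" for i
    using that by (simp add: less_mult_imp_div_less mult.commute)
  \<comment> \<open>Tree edges join vertices of equal index, cycle edges those of successive
    indices; \<open>same\<close> and \<open>succ\<close> express both relations by positions and
    blocks.\<close>
  have same: "i = j \<longleftrightarrow> i mod m = j mod m \<and> Q i j" if "i < m * n" "j < m * n" for i j
  proof
    assume *: "i mod m = j mod m \<and> Q i j"
    then have "[int (j div m) = int (i div m)] (mod int n)"
      using W_same[of "j mod m"] by (auto simp: Q_def)
    then have "j div m = i div m"
      using div_less that by (intro cong_int_less_imp_eq[where n = n]) auto
    then show "i = j"
      using * by (metis div_mult_mod_eq)
  qed (simp add: Q_def W_same)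
  have succ: "j = Suc i mod (m * n) \<longleftrightarrow> j mod m = Suc (i mod m) mod m \<and> Q i j"
    if "i < m * n" "j < m * n" for i j
  proof -
    have "0 < m" "i mod m < m"
      using m by simp_all
    then show ?thesis
      using Suc_mod_mult_iff[OF \<open>0 < m\<close> that] W_Suc[of "i mod m"] unfolding Q_def by auto
  qed
  have Q_swap: "Q j i \<longleftrightarrow> Q i j" for i j
  proof -
    have "Q j i \<longleftrightarrow> [int (i div m) + W (i mod m) (j mod m) = int (j div m)] (mod int n)"
      unfolding Q_def W_swap[of "j mod m" "i mod m"] by (simp add: cong_iff_dvd_diff algebra_simps)
    then show ?thesis
      unfolding Q_def by (simp only: cong_sym_eq)
  qed
  have edge_iff: "{x, y} \<in> edges ?H \<longleftrightarrow> {p x, p y} \<in> edges ?G \<and>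
      [int (lev y) = int (lev x) + d (p x) (p y)] (mod int n)"
    if "x \<in> verts ?H" "y \<in> verts ?H" for x y
  proof -
    have xy: "fst x < m * n" "fst y < m * n" "fst x mod m < m" "fst y mod m < m"
      using that vH m by auto
    show ?thesis
      unfolding lev_cong edge_unicyclic_graph_iff length_unicyclic_power
      using xy same[OF xy(1,2)] succ[OF xy(1,2)] succ[OF xy(2,1)] Q_swap[of "fst x" "fst y"]
      by (simp add: p_def nth_unicyclic_power flip: m_def) blast
  qed
  have step: "P y - P x + t * W (fst x) (fst y) = 1 \<or> P y - P x + t * W (fst x) (fst y) = -1"
    if "fst x < m" "fst y = Suc (fst x) mod m" "snd x = snd (ts ! fst x)" "snd y = snd (ts ! fst y)" for x y
  proof -
    have "P x = int (fst x mod 2)" "P y = int (fst y mod 2)"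
      using that c(1)[of "fst x"] c(1)[of "fst y"] m by (auto simp: P_def case_prod_beta)
    moreover have "W (fst x) (fst y) = (if Suc (fst x) = m then 1 else 0)"
      using W_Suc that by simp
    ultimately show ?thesis
      using that by (cases "even (fst x)"; cases "Suc (fst x) = m")
        (auto simp: t_def elim!: evenE oddE, presburger+)
  qed
  have voltage: "[2 * d x y = 1] (mod int n) \<or> [2 * d x y = -1] (mod int n)" if "{x, y} \<in> edges ?G" for x y
  proof -
    define e where "e = P y - P x + t * W (fst x) (fst y)"
    have "e = 1 \<or> e = -1"
      using that unfolding edge_unicyclic_graph_iff m_def[symmetric]
    proof (elim disjE conjE)
      assume "fst x < m" "fst x = fst y" "{snd x, snd y} \<in> edges (fst (ts ! fst x))"
      then show ?thesis
        using c(2)[of "fst x" "snd x" "snd y"] m by (auto simp: e_def P_def W_def case_prod_beta)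
    next
      assume "fst x < m" "fst y < m" "snd x = snd (ts ! fst x)" "snd y = snd (ts ! fst y)"
        "fst y = Suc (fst x) mod m"
      then show ?thesis
        using step[of x y] by (simp add: e_def)
    next
      assume "fst x < m" "fst y < m" "snd x = snd (ts ! fst x)" "snd y = snd (ts ! fst y)"
        "fst x = Suc (fst y) mod m"
      then show ?thesis
        using step[of y x] W_swap[of "fst x" "fst y"] by (auto simp: e_def)
    qed
    moreover have "2 * d x y = 2 * s * e"
      by (simp add: d_def e_def)
    ultimately show ?thesis
      using cong_mult[OF s, of e e] by auto
  qed
  obtain b where b: "[t * b = 1] (mod int n)"
    using cong_solve_coprime_int[OF t] by blast
  have "inj_on (\<lambda>x. (p x, lev x)) (verts ?H)"
  proof (rule inj_onI)
    fix x y assume *: "x \<in> verts ?H" "y \<in> verts ?H" "(p x, lev x) = (p y, lev y)"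
    then have "fst x mod m = fst y mod m" "snd x = snd y"
      by (auto simp: p_def)
    \<comment> \<open>Equal projections make the voltage 0, so equal levels give equal
      blocks.\<close>
    moreover have "d (p x) (p y) = 0"
      using * by (simp add: d_def W_same)
    then have "Q (fst x) (fst y)"
      using lev_cong[of y x] * by simp
    ultimately show "x = y"
      using same[of "fst x" "fst y"] * vH by (auto simp: prod_eq_iff)
  qed
  moreover have "(\<lambda>x. (p x, lev x)) ` verts ?H = verts ?G \<times> {..<n}"
  proof (intro subset_antisym subsetI)
    fix z assume "z \<in> (\<lambda>x. (p x, lev x)) ` verts ?H"
    then obtain x where "x \<in> verts ?H" "z = (p x, lev x)"
      by auto
    then show "z \<in> verts ?G \<times> {..<n}"
      using vH[of x] m n by (auto simp: p_def lev_def verts_unicyclic_graph nat_less_iff m_def[symmetric])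
  next
    fix z assume "z \<in> verts ?G \<times> {..<n}"
    then obtain j v r where z: "z = ((j, v), r)" "j < m" "v \<in> verts (fst (ts ! j))" "r < n"
      by (auto simp: verts_unicyclic_graph m_def)
    \<comment> \<open>The block \<open>q\<close> solves \<open>s * (t * q + P (j, v)) = r\<close>
      modulo \<open>n\<close>, since 2 is the inverse of \<open>s\<close> and \<open>b\<close> that
      of \<open>t\<close>.\<close>
    define q where "q = nat ((b * (2 * int r - P (j, v))) mod int n)"
    have q: "[int q = b * (2 * int r - P (j, v))] (mod int n)" "q < n"
      using n by (simp_all add: q_def cong_def nat_less_iff)
    define x where "x = (m * q + j, v)"
    have x: "fst x div m = q" "p x = (j, v)"
      using z(2) by (simp_all add: x_def p_def)
    have "m * q + j < m * Suc q"
      using z(2) by simp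
    also have "\<dots> \<le> m * n"
      using q(2) by (intro mult_le_mono2) simp
    finally have "x \<in> verts ?H"
      using z(2,3) by (simp add: vH x_def)
    have "[int (lev x) = s * (t * int q + P (j, v))] (mod int n)"
      using x by (simp add: lev cong_def)
    also have "[s * (t * int q + P (j, v)) = s * (t * (b * (2 * int r - P (j, v))) + P (j, v))] (mod int n)"
      using q(1) by (intro cong_scalar_left cong_add) auto
    also have "s * (t * (b * (2 * int r - P (j, v))) + P (j, v)) =
        s * (t * b * (2 * int r - P (j, v)) + P (j, v))"
      by (simp add: mult.assoc)
    also have "[\<dots> = s * (1 * (2 * int r - P (j, v)) + P (j, v))] (mod int n)"
      using b by (intro cong_scalar_left cong_scalar_right cong_add) auto
    also have "s * (1 * (2 * int r - P (j, v)) + P (j, v)) = 2 * s * int r"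
      by simp
    also have "[\<dots> = 1 * int r] (mod int n)"
      using s by (rule cong_scalar_right)
    finally have "[int (lev x) = int r] (mod int n)"
      by simp
    moreover have "lev x < n"
      using n by (simp add: lev_def nat_less_iff)
    ultimately have "lev x = r"
      using z(4) by (intro cong_int_less_imp_eq[where n = n])
    then show "z \<in> (\<lambda>x. (p x, lev x)) ` verts ?H"
      using z(1) x(2) \<open>x \<in> verts ?H\<close> by (intro image_eqI[of _ _ x]) auto
  qed
  moreover have "\<exists>x\<in>verts ?H. \<exists>y\<in>verts ?H. e = {x, y}" if "e \<in> edges ?H" for e
    using unicyclic_graph_edge_ends[OF unicyclic_power_unicyclic[OF ts n] that] by metis
  ultimately have "cyclic_cover n ?G ?H p lev d"
    unfolding cyclic_cover_def bij_betw_def using edge_iff voltage by blast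
  then show ?thesis by blast
qed

section \<open>One cover of the whole sum from the covers of its components\<close>

theorem theorem4p3:
  fixes n l :: nat
    and T :: "nat \<Rightarrow> 'a unicyclic"
    and J :: "nat set"
  defines "I \<equiv> {1..l}"
  defines "G \<equiv> disjoint_sum I (\<lambda>i. unicyclic_graph (T i))"
  defines "H \<equiv> disjoint_plus
      (disjoint_sum J (\<lambda>j. copies n (unicyclic_graph (T j))))
      (disjoint_sum (I - J) (\<lambda>i. unicyclic_graph (unicyclic_power (T i) n)))"
  assumes "odd n" and "1 \<le> l"
    and "\<And>i. i \<in> I \<Longrightarrow> unicyclic (T i)"
    and "J \<subseteq> I"
    and "\<And>i. i \<in> J \<Longrightarrow> odd (length (T i)) \<Longrightarrow> n \<le> length (T i)"
  shows "((\<exists>f. edge_magic_labeling G f) \<longrightarrow> (\<exists>g. edge_magic_labeling H g)) \<and>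
         ((\<exists>f. super_edge_magic_labeling G f) \<longrightarrow> (\<exists>g. super_edge_magic_labeling H g))"
proof -
  have "\<exists>p lev d. cyclic_cover n (unicyclic_graph (T i)) (copies n (unicyclic_graph (T i))) p lev d"
    if "i \<in> J" for i
    using that assms by (intro unicyclic_cover_copies) auto
  moreover have "\<exists>p lev d. cyclic_cover n (unicyclic_graph (T i))
      (unicyclic_graph (unicyclic_power (T i) n)) p lev d" if "i \<in> I - J" for i
    using that assms by (intro unicyclic_cover_power) auto
  ultimately obtain p lev d where "cyclic_cover n G H p lev d"
    unfolding G_def H_def using cyclic_cover_disjoint_sum[OF \<open>J \<subseteq> I\<close>] by metis
  moreover have "simple_graph G"
    unfolding G_def using assms by (intro simple_graph_disjoint_sum simple_graph_unicyclic_graph) auto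
  ultimately show ?thesis
    using cyclic_cover_labeling[OF \<open>odd n\<close>] by meson
qed

end
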